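(* Assume $\mathrm{add}(\mathcal M)=\mathfrak c$. Then the poset of meager Borel subsets of the Baire space $\omega^\omega$, ordered by inclusion, is not reversible.
   Context: $\mathfrak c=2^{\aleph_0}$. $\mathcal M$ is the ideal of meager (first category) subsets of $\omega^\omega$ and $\mathrm{add}(\mathcal M)$ is the least cardinality of a family of meager sets whose union is not meager. A poset $\langle P,\leq\rangle$ is reversible iff each bijection $f:P\to P$ with $x\leq y\Rightarrow f(x)\leq f(y)$ for all $x,y\in P$ is an automorphism. *)

theory Defs
  imports "HOL-Analysis.Analysis"
begin

unbundle cardinal_syntax

definition nowhere_dense :: "'a::topological_space set \<Rightarrow> bool" where
  "nowhere_dense A \<longleftrightarrow> interior (closure A) = {}"

definition meager :: "'a::topological_space set \<Rightarrow> bool" where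
  "meager A \<longleftrightarrow> (\<exists>N :: nat \<Rightarrow> 'a set. (\<forall>n. nowhere_dense (N n)) \<and> A = (\<Union>n. N n))"

text \<open>The Baire space is the type \<^typ>\<open>nat \<Rightarrow> nat\<close>; its topology as an instance of
  \<^class>\<open>topological_space\<close> is the product of the discrete topologies.\<close>

definition nonadditive_families :: "(nat \<Rightarrow> nat) set set set" where
  "nonadditive_families = {F. (\<forall>A\<in>F. meager A) \<and> \<not> meager (\<Union>F)}"

text \<open>Cardinals are represented by cardinal orders, which are unique only up to \<open>=o\<close>; hence
  the choice operator for the least one.\<close>

definition add_meager :: "(nat \<Rightarrow> nat) set rel" where
  "add_meager = (SOME \<kappa>. \<kappa> \<in> card_of ` nonadditive_families \<and>
                         (\<forall>\<mu> \<in> card_of ` nonadditive_families. \<kappa> \<le>o \<mu>))"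

abbreviation continuum :: "(nat \<Rightarrow> bool) rel" where
  "continuum \<equiv> ctwo ^c natLeq"

definition poset_automorphism :: "'a set \<Rightarrow> ('a \<Rightarrow> 'a \<Rightarrow> bool) \<Rightarrow> ('a \<Rightarrow> 'a) \<Rightarrow> bool" where
  "poset_automorphism P le f \<longleftrightarrow>
     bij_betw f P P \<and> (\<forall>x\<in>P. \<forall>y\<in>P. le x y \<longleftrightarrow> le (f x) (f y))"

definition reversible_poset :: "'a set \<Rightarrow> ('a \<Rightarrow> 'a \<Rightarrow> bool) \<Rightarrow> bool" where
  "reversible_poset P le \<longleftrightarrow>
     (\<forall>f. bij_betw f P P \<and> monotone_on P le le f \<longrightarrow> poset_automorphism P le f)"

text \<open>The remaining lemmas show that \<^const>\<open>add_meager\<close> is well defined: by the Baire category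
  theorem the family of all singletons is nonadditive.\<close>

lemma completely_metrizable_Baire_space:
  "completely_metrizable_space (euclidean :: (nat \<Rightarrow> nat) topology)"
proof -
  have "open S" for S :: "nat set" by (rule open_discrete)
  then have "(euclidean :: nat topology) = discrete_topology UNIV"
    by (simp add: topology_eq)
  then show ?thesis
    by (simp add: completely_metrizable_space_discrete_topology
      completely_metrizable_space_product_topology flip: euclidean_product_topology)
qed

lemma not_meager_UNIV: "\<not> meager (UNIV :: (nat \<Rightarrow> nat) set)"
proof
  assume "meager (UNIV :: (nat \<Rightarrow> nat) set)"
  then obtain N :: "nat \<Rightarrow> (nat \<Rightarrow> nat) set"
    where N: "\<And>n. nowhere_dense (N n)" "UNIV = (\<Union>n. N n)"
    unfolding meager_def by blast
  have "euclidean interior_of \<Union>(range (\<lambda>n. closure (N n))) = {}"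
    using N(1) by (intro Baire_category_alt disjI1 completely_metrizable_Baire_space)
      (auto simp: nowhere_dense_def)
  moreover have "\<Union>(range (\<lambda>n. closure (N n))) = UNIV"
    using N(2) closure_subset by blast
  ultimately show False by simp
qed

lemma meager_singleton: "meager {x :: nat \<Rightarrow> nat}"
proof -
  have "\<not> open {x}"
  proof
    assume "open {x}"
    then obtain X where X: "x \<in> Pi\<^sub>E UNIV X" "finite {i. X i \<noteq> topspace euclidean}"
      "Pi\<^sub>E UNIV X \<subseteq> {x}"
      using product_topology_open_contains_basis[of "\<lambda>_. euclidean" UNIV "{x}" x]
      by (auto simp: open_fun_def)
    have "{i. X i \<noteq> topspace euclidean} \<noteq> (UNIV :: nat set)"
      using X(2) infinite_UNIV_nat by metis
    then obtain i where "X i = UNIV" by auto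
    then have "x(i := Suc (x i)) \<in> Pi\<^sub>E UNIV X" using X(1) by auto
    then have "x(i := Suc (x i)) = x" using X(3) by auto
    then have "(x(i := Suc (x i))) i = x i" by (rule fun_cong)
    then show False by simp
  qed
  moreover have "closed {x}"
    using closedin_t1_singleton[of euclidean x] completely_metrizable_Baire_space
    by (simp add: completely_metrizable_imp_metrizable_space metrizable_imp_t1_space)
  ultimately have "nowhere_dense {x}"
    using interior_subset[of "{x}"] interior_eq[of "{x}"]
    by (auto simp: nowhere_dense_def subset_singleton_iff closure_closed)
  then show ?thesis unfolding meager_def by (intro exI[of _ "\<lambda>_. {x}"]) auto
qed

lemma nonadditive_families_nonempty: "nonadditive_families \<noteq> {}"
proof -
  have "\<Union>(range (\<lambda>x :: nat \<Rightarrow> nat. {x})) = UNIV" by auto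
  then have "range (\<lambda>x. {x}) \<in> nonadditive_families"
    using not_meager_UNIV meager_singleton by (auto simp: nonadditive_families_def)
  then show ?thesis by blast
qed

lemma add_meager_least:
  "add_meager \<in> card_of ` nonadditive_families"
  "F \<in> nonadditive_families \<Longrightarrow> add_meager \<le>o |F|"
proof -
  have "\<exists>\<kappa> \<in> card_of ` nonadditive_families.
          \<forall>\<mu> \<in> card_of ` nonadditive_families. \<kappa> \<le>o \<mu>"
    using nonadditive_families_nonempty by (intro exists_minim_Card_order) (auto simp: card_of_Card_order)
  then have *: "add_meager \<in> card_of ` nonadditive_families \<and>
      (\<forall>\<mu> \<in> card_of ` nonadditive_families. add_meager \<le>o \<mu>)"
    unfolding add_meager_def Bex_def by (rule someI_ex)
  then show "add_meager \<in> card_of ` nonadditive_families"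
    "F \<in> nonadditive_families \<Longrightarrow> add_meager \<le>o |F|" by auto
qed

end

theory Submission
  imports Defs
begin

text \<open>Since all unions of fewer than \<open>\<cc>\<close> meager sets are meager and there are only \<open>\<cc>\<close> Borel
  sets, there is a cofinal chain \<open>N\<^sub>\<alpha>\<close>, \<open>\<alpha> < \<cc>\<close>, of meager Borel sets. It can be chosen together
  with Borel embeddings \<open>e\<^sub>\<alpha>\<close> of the whole space onto meager sets disjoint from \<open>N\<^sub>\<alpha>\<close>, with
  \<open>N\<^sub>\<alpha> \<union> ran e\<^sub>\<alpha> \<subseteq> N\<^sub>\<beta>\<close> for \<open>\<alpha> < \<beta>\<close>. Let \<open>\<rho>(A)\<close> be the least \<open>\<alpha>\<close> with \<open>A \<subseteq> N\<^sub>\<alpha>\<close>. A set \<open>A\<close> with at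
  least two points is sent to \<open>N\<^sub>\<alpha> \<union> e\<^sub>\<alpha>[A]\<close> where \<open>\<alpha> = \<rho>(A)\<close>; this is injective and monotone.
  A singleton lies above nothing but \<open>\<emptyset>\<close>, so \<open>{a}\<close> may be sent to anything inside \<open>N\<^sub>\<rho>\<close> with
  \<open>\<rho> = \<rho>({a})\<close>, and Cantor--Bernstein matches the singletons in this way with the nonempty sets still
  to be hit: glue \<open>a \<mapsto> {a}\<close> with the inverse of \<open>A \<mapsto> e\<^sub>\<alpha>(code of A)\<close>, \<open>\<alpha> = \<rho>(A)\<close>.
  Among these are \<open>{p}\<close> and \<open>{p, q}\<close>, which are comparable although their preimages are distinct
  singletons.\<close>

section \<open>Cylinders, nowhere dense sets and meager sets\<close>

definition cyl :: "nat list \<Rightarrow> (nat \<Rightarrow> nat) set" where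
  "cyl s = {x. \<forall>i<length s. x i = s ! i}"

lemma cyl_append: "cyl (s @ t) \<subseteq> cyl s"
  by (auto simp: cyl_def nth_append)

lemma cyl_nonempty: "cyl s \<noteq> {}"
proof -
  have "(\<lambda>i. s ! i) \<in> cyl s" by (simp add: cyl_def)
  then show ?thesis by blast
qed

lemma open_cyl: "open (cyl s)"
proof -
  have "open ((\<lambda>x :: nat \<Rightarrow> nat. x i) -` {k})" for i k
    by (intro open_vimage open_discrete continuous_on_product_coordinates)
  then have "open (\<Inter>i\<in>{..<length s}. (\<lambda>x. x i) -` {s ! i})"
    by (intro open_INT) auto
  also have "(\<Inter>i\<in>{..<length s}. (\<lambda>x. x i) -` {s ! i}) = cyl s"
    by (auto simp: cyl_def)
  finally show ?thesis .
qed

text \<open>A basic open box restrains only finitely many coordinates, so an initial segment of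
  \<open>x\<close> long enough to cover them decides membership.\<close>

lemma open_contains_cyl:
  assumes "open U" "x \<in> U"
  shows "\<exists>n. cyl (map x [0..<n]) \<subseteq> U"
proof -
  obtain X where X: "x \<in> Pi\<^sub>E UNIV X" "finite {i. X i \<noteq> UNIV}" "Pi\<^sub>E UNIV X \<subseteq> U"
    using product_topology_open_contains_basis[of "\<lambda>_. euclidean" UNIV U x] assms
    by (auto simp: open_fun_def)
  obtain n where n: "\<forall>i\<in>{i. X i \<noteq> UNIV}. i < n"
    using X(2) finite_nat_set_iff_bounded by blast
  have "y \<in> U" if "y \<in> cyl (map x [0..<n])" for y
  proof -
    have "y i \<in> X i" for i
    proof (cases "X i = UNIV")
      case False
      then have "i < n" using n by blast
      then have "y i = x i" using that by (simp add: cyl_def)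
      then show ?thesis using X(1) by auto
    qed simp
    then show ?thesis using X(3) by auto
  qed
  then show ?thesis by blast
qed

text \<open>Cylinders form a base, and an open set that misses \<open>A\<close> misses its closure.
  In this form the extension \<open>t\<close> can be chosen stage by stage when a tree is
  built.\<close>

lemma nowhere_dense_iff_cyl:
  "nowhere_dense A \<longleftrightarrow> (\<forall>s. \<exists>t. cyl (s @ t) \<inter> A = {})"
proof
  assume A: "nowhere_dense A"
  show "\<forall>s. \<exists>t. cyl (s @ t) \<inter> A = {}"
  proof
    fix s
    have "\<not> cyl s \<subseteq> closure A"
      using A cyl_nonempty[of s] interior_maximal[OF _ open_cyl[of s]]
      by (auto simp: nowhere_dense_def)
    then obtain x where x: "x \<in> cyl s" "x \<in> - closure A" by blast
    obtain n where n: "cyl (map x [0..<n]) \<subseteq> - closure A"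
      using open_contains_cyl[OF _ x(2)] by auto
    have "map x [0..<length s] = s"
      using x(1) by (intro nth_equalityI) (auto simp: cyl_def)
    then have "cyl (s @ map x [length s..<length s + n]) = cyl (map x [0..<length s + n])"
      by (metis map_append upt_add_eq_append zero_le)
    also have "\<dots> \<subseteq> cyl (map x [0..<n])" by (auto simp: cyl_def)
    finally show "\<exists>t. cyl (s @ t) \<inter> A = {}"
      using n closure_subset[of A] by blast
  qed
next
  assume A: "\<forall>s. \<exists>t. cyl (s @ t) \<inter> A = {}"
  show "nowhere_dense A"
    unfolding nowhere_dense_def
  proof (rule ccontr)
    assume "interior (closure A) \<noteq> {}"
    then obtain x n where n: "cyl (map x [0..<n]) \<subseteq> interior (closure A)"
      using open_contains_cyl[OF open_interior] by blast
    obtain t where t: "cyl (map x [0..<n] @ t) \<inter> A = {}" using A by blast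
    then have "cyl (map x [0..<n] @ t) \<inter> closure A = {}"
      using open_Int_closure_eq_empty[OF open_cyl] by blast
    then show False
      using n cyl_append[of "map x [0..<n]" t] cyl_nonempty[of "map x [0..<n] @ t"]
        interior_subset[of "closure A"] by blast
  qed
qed

lemma meager_subset:
  assumes "meager A" "B \<subseteq> A"
  shows "meager B"
proof -
  obtain N where N: "\<forall>n::nat. nowhere_dense (N n)" "A = (\<Union>n. N n)"
    using assms(1) unfolding meager_def by blast
  have "nowhere_dense (N n \<inter> B)" for n
    using N(1) interior_mono[OF closure_mono[of "N n \<inter> B" "N n"]]
    by (auto simp: nowhere_dense_def)
  moreover have "B = (\<Union>n. N n \<inter> B)" using N(2) assms(2) by blast
  ultimately show ?thesis unfolding meager_def by (intro exI[of _ "\<lambda>n. N n \<inter> B"]) simp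
qed

text \<open>Closures of nowhere dense sets are nowhere dense, and a countable union of closed sets
  is Borel.\<close>

lemma meager_Borel_hull:
  assumes "meager A"
  shows "\<exists>B. A \<subseteq> B \<and> B \<in> sets borel \<and> meager B"
proof -
  obtain N where N: "\<forall>n::nat. nowhere_dense (N n)" "A = (\<Union>n. N n)"
    using assms unfolding meager_def by blast
  have "meager (\<Union>n. closure (N n))"
    using N(1) unfolding meager_def nowhere_dense_def
    by (intro exI[of _ "\<lambda>n. closure (N n)"]) simp
  moreover have "A \<subseteq> (\<Union>n. closure (N n))" using N(2) closure_subset by blast
  ultimately show ?thesis by (intro exI[of _ "\<Union>n. closure (N n)"]) auto
qed

section \<open>Embedding the space along a nowhere dense tree\<close>

text \<open>\<open>X\<close> acts as a strategy: in the application, \<open>X n s\<close> extends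
  \<open>s\<close> to a cylinder that misses the \<open>n\<close>-th nowhere dense set. The digit
  \<open>a n\<close> is the free choice at stage \<open>n\<close>.\<close>

primrec stem :: "(nat \<Rightarrow> nat list \<Rightarrow> nat list) \<Rightarrow> (nat \<Rightarrow> nat) \<Rightarrow> nat \<Rightarrow> nat list" where
  "stem X a 0 = []"
| "stem X a (Suc n) = stem X a n @ [a n, 0] @ X n (stem X a n @ [a n, 0])"

text \<open>Stage \<open>Suc i\<close> is late enough: the stem then has length at least
  \<open>Suc i\<close>, and later stages only extend it.\<close>

definition branch :: "(nat \<Rightarrow> nat list \<Rightarrow> nat list) \<Rightarrow> (nat \<Rightarrow> nat) \<Rightarrow> nat \<Rightarrow> nat" where
  "branch X a i = stem X a (Suc i) ! i"

text \<open>Rebuilds the stems from the branch alone, since \<open>a n\<close> stands right after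
  the \<open>n\<close>-th stem. This leads to an explicit left inverse of
  \<open>branch X\<close>.\<close>

primrec unstem :: "(nat \<Rightarrow> nat list \<Rightarrow> nat list) \<Rightarrow> (nat \<Rightarrow> nat) \<Rightarrow> nat \<Rightarrow> nat list" where
  "unstem X y 0 = []"
| "unstem X y (Suc n) = (let s = unstem X y n @ [y (length (unstem X y n)), 0] in s @ X n s)"

definition unbranch :: "(nat \<Rightarrow> nat list \<Rightarrow> nat list) \<Rightarrow> (nat \<Rightarrow> nat) \<Rightarrow> nat \<Rightarrow> nat" where
  "unbranch X y n = y (length (unstem X y n))"

lemma length_stem: "n \<le> length (stem X a n)"
  by (induction n) auto

lemma stem_mono: "m \<le> n \<Longrightarrow> \<exists>t. stem X a n = stem X a m @ t"
  by (induction rule: dec_induct) auto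

lemma branch_in_cyl_stem: "branch X a \<in> cyl (stem X a n)"
proof -
  have "stem X a (Suc i) ! i = stem X a n ! i" if i: "i < length (stem X a n)" for i
  proof (cases "Suc i \<le> n")
    case True
    then obtain t where "stem X a n = stem X a (Suc i) @ t" using stem_mono by blast
    then show ?thesis using length_stem[of "Suc i" X a] by (simp add: nth_append del: stem.simps)
  next
    case False
    then obtain t where "stem X a (Suc i) = stem X a n @ t"
      using stem_mono[of n "Suc i" X a] by auto
    then show ?thesis using i by (simp add: nth_append)
  qed
  then show ?thesis by (simp add: cyl_def branch_def)
qed

lemma branch_at_split:
  "branch X a (length (stem X a n)) = a n" "branch X a (Suc (length (stem X a n))) = 0"
  using branch_in_cyl_stem[of X a "Suc n"] by (auto simp: cyl_def nth_append)

lemma unstem_branch: "unstem X (branch X a) n = stem X a n"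
  by (induction n) (auto simp: Let_def branch_at_split)

lemma unbranch_branch: "unbranch X (branch X a) = a"
  by (rule ext) (simp add: unbranch_def unstem_branch branch_at_split)

lemma inj_branch: "inj (branch X)"
  by (rule inj_on_inverseI[of _ "unbranch X"]) (simp add: unbranch_branch)

lemma branch_avoids:
  assumes "\<And>n s. cyl (s @ X n s) \<inter> F n = {}"
  shows "branch X a \<notin> (\<Union>n. F n)"
  using assms[of "stem X a n @ [a n, 0]" n for n] branch_in_cyl_stem[of X a "Suc n" for n]
  by auto

text \<open>The symbol \<open>0\<close> after each splitting node is what makes the tree of stems nowhere dense.\<close>

lemma nowhere_dense_range_branch: "nowhere_dense (range (branch X))"
  unfolding nowhere_dense_iff_cyl
proof
  fix s
  show "\<exists>t. cyl (s @ t) \<inter> range (branch X) = {}"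
  proof (cases "\<exists>a. branch X a \<in> cyl s")
    case False
    then show ?thesis by (intro exI[of _ "[]"]) auto
  next
    case True
    then obtain a where a: "branch X a \<in> cyl s" by blast
    \<comment> \<open>Every stage lengthens the stem, so after \<open>length s\<close> stages it
      extends \<open>s\<close>. After \<open>?u\<close> come a free digit and the marker
      \<open>0\<close>; asking for \<open>1\<close> at the marker excludes all branches.\<close>
    let ?u = "stem X a (length s)"
    have "take (length s) ?u = s"
      using a branch_in_cyl_stem[of X a "length s"] length_stem[of "length s" X a]
      by (intro nth_equalityI) (auto simp: cyl_def)
    then have eq: "s @ drop (length s) ?u @ [0, 1] = ?u @ [0, 1]"
      by (metis append.assoc append_take_drop_id)
    have "branch X b \<notin> cyl (?u @ [0, 1])" for b
    proof
      assume b: "branch X b \<in> cyl (?u @ [0, 1])"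
      then have bu: "branch X b \<in> cyl ?u" using cyl_append by blast
      \<comment> \<open>Both branches pass through \<open>?u\<close>, from which their free digits
        are read off. Hence \<open>?u\<close> is also a stem of \<open>b\<close>, with the marker at
        the same place.\<close>
      have "stem X b k = stem X a k" if "k \<le> length s" for k
        using that
      proof (induction k)
        case (Suc k)
        obtain t where t: "?u = stem X a (Suc k) @ t" using stem_mono[OF Suc.prems] by blast
        have "b k = branch X b (length (stem X a k))"
          using branch_at_split(1)[of X b k] Suc by simp
        also have "\<dots> = ?u ! length (stem X a k)" using bu t by (simp add: cyl_def)
        also have "\<dots> = a k" by (simp add: t nth_append)
        finally show ?case using Suc by simp
      qed simp
      then have "branch X b (Suc (length ?u)) = 0"
        using branch_at_split(2)[of X b "length s"] by simp
      moreover have "branch X b (Suc (length ?u)) = 1"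
        using b by (auto simp: cyl_def nth_append)
      ultimately show False by simp
    qed
    then show ?thesis by (intro exI[of _ "drop (length s) ?u @ [0, 1]"]) (auto simp only: eq)
  qed
qed

section \<open>Borel measurability of the embedding and of its inverse\<close>

lemma measurable_coord: "(\<lambda>x :: nat \<Rightarrow> nat. x i) \<in> borel_measurable borel"
  by (rule borel_measurable_continuous_onI[OF continuous_on_product_coordinates])

lemma measurable_coord_count_space:
  "(\<lambda>x :: nat \<Rightarrow> nat. x i) \<in> borel \<rightarrow>\<^sub>M count_space UNIV"
proof -
  have "(\<lambda>x :: nat \<Rightarrow> nat. x i) \<in> borel_measurable borel" by (rule measurable_coord)
  moreover have "sets (borel :: nat measure) = sets (count_space UNIV)"
    by (simp add: sets_borel_eq_count_space)
  ultimately show ?thesis using measurable_cong_sets by blast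
qed

lemma measurable_fun_of_coord:
  "(\<lambda>x :: nat \<Rightarrow> nat. g (x i)) \<in> borel \<rightarrow>\<^sub>M count_space UNIV"
  by (rule measurable_compose[OF measurable_coord_count_space, where g = g]) simp

text \<open>There are only countably many lists, so the previous stem may be held fixed; the next
  one then depends on the single coordinate \<open>a n\<close>.\<close>

lemma measurable_stem: "(\<lambda>a. stem X a n) \<in> borel \<rightarrow>\<^sub>M count_space UNIV"
proof (induction n)
  case (Suc n)
  let ?f = "\<lambda>s a. s @ [a n, 0] @ X n (s @ [a n, 0])"
  have "?f s \<in> borel \<rightarrow>\<^sub>M count_space UNIV" for s
    by (rule measurable_fun_of_coord[of "\<lambda>k. s @ [k, 0] @ X n (s @ [k, 0])" n])
  then have "(\<lambda>a. ?f (stem X a n) a) \<in> borel \<rightarrow>\<^sub>M count_space UNIV"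
    by (rule measurable_compose_countable[where f = ?f, OF _ Suc.IH])
  then show ?case by (simp only: stem.simps)
qed (simp only: stem.simps measurable_const space_count_space UNIV_I)

lemma measurable_unstem: "(\<lambda>y. unstem X y n) \<in> borel \<rightarrow>\<^sub>M count_space UNIV"
proof (induction n)
  case (Suc n)
  let ?f = "\<lambda>s y. let u = s @ [y (length s), 0] in u @ X n u"
  have "?f s \<in> borel \<rightarrow>\<^sub>M count_space UNIV" for s
    by (rule measurable_fun_of_coord[of "\<lambda>k. let u = s @ [k, 0] in u @ X n u" "length s"])
  then have "(\<lambda>y. ?f (unstem X y n) y) \<in> borel \<rightarrow>\<^sub>M count_space UNIV"
    by (rule measurable_compose_countable[where f = ?f, OF _ Suc.IH])
  then show ?case by (simp only: unstem.simps)
qed (simp only: unstem.simps measurable_const space_count_space UNIV_I)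

lemma measurable_branch: "branch X \<in> borel_measurable borel"
proof (rule measurable_coordinatewise_then_product)
  fix i
  show "(\<lambda>a. branch X a i) \<in> borel_measurable borel"
    unfolding branch_def
    by (rule measurable_compose[OF measurable_stem, where g = "\<lambda>l. l ! i"]) simp
qed

lemma measurable_unbranch: "unbranch X \<in> borel_measurable borel"
proof (rule measurable_coordinatewise_then_product)
  fix n
  show "(\<lambda>y. unbranch X y n) \<in> borel_measurable borel"
    unfolding unbranch_def
    by (rule measurable_compose_countable
        [where f = "\<lambda>s y. y (length s)", OF measurable_coord measurable_unstem])
qed

text \<open>As the left inverse \<open>unbranch X\<close> is Borel, the range is the Borel set of
  points fixed by \<open>unbranch X\<close> followed by \<open>branch X\<close>; the image is its
  part whose \<open>unbranch X\<close> values lie in \<open>A\<close>.\<close>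

lemma Borel_branch_image:
  assumes "A \<in> sets borel"
  shows "branch X ` A \<in> sets borel"
proof -
  have "(\<lambda>y. branch X (unbranch X y)) \<in> borel_measurable borel"
    by (rule measurable_compose[OF measurable_unbranch measurable_branch])
  then have m: "(\<lambda>y. branch X (unbranch X y) i) \<in> borel_measurable borel" for i
    by (rule measurable_compose[OF _ measurable_coord[of i]])
  have "{y \<in> space borel. branch X (unbranch X y) i = y i} \<in> sets borel" for i
    by (rule measurable_equality_set[OF m measurable_coord])
  then have "(\<Inter>i. {y. branch X (unbranch X y) i = y i}) \<in> sets borel"
    by (intro sets.countable_INT'') auto
  moreover have "unbranch X -` A \<in> sets borel"
    by (rule measurable_sets_borel[OF measurable_unbranch assms])
  moreover have "branch X ` A = (\<Inter>i. {y. branch X (unbranch X y) i = y i}) \<inter> unbranch X -` A"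
  proof (intro equalityI subsetI)
    fix y assume "y \<in> (\<Inter>i. {y. branch X (unbranch X y) i = y i}) \<inter> unbranch X -` A"
    then have "y = branch X (unbranch X y)" "unbranch X y \<in> A" by (auto simp: fun_eq_iff)
    then show "y \<in> branch X ` A" by (rule image_eqI)
  qed (auto simp: unbranch_branch)
  ultimately show ?thesis by (simp only: sets.Int)
qed

lemma meager_avoiding_embedding:
  assumes "meager (M :: (nat \<Rightarrow> nat) set)"
  shows "\<exists>e :: (nat \<Rightarrow> nat) \<Rightarrow> nat \<Rightarrow> nat. inj e \<and> range e \<inter> M = {} \<and> meager (range e) \<and>
           (\<forall>A\<in>sets borel. e ` A \<in> sets borel)"
proof -
  obtain F where F: "\<And>n::nat. nowhere_dense (F n)" "M = (\<Union>n. F n)"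
    using assms unfolding meager_def by blast
  have "\<forall>n s. \<exists>t. cyl (s @ t) \<inter> F n = {}" using F(1) by (simp add: nowhere_dense_iff_cyl)
  then obtain X where X: "\<And>n s. cyl (s @ X n s) \<inter> F n = {}" by metis
  have "meager (range (branch X))"
    using nowhere_dense_range_branch unfolding meager_def
    by (intro exI[of _ "\<lambda>_. range (branch X)"]) simp
  moreover have "branch X a \<notin> M" for a
    unfolding F(2) by (rule branch_avoids) (rule X)
  ultimately show ?thesis
    using inj_branch Borel_branch_image by (intro exI[of _ "branch X"]) (auto simp del: UN_iff)
qed

lemma closed_singleton_Baire_space: "closed {x :: nat \<Rightarrow> nat}"
  using closedin_t1_singleton[of euclidean x] completely_metrizable_Baire_space
  by (simp add: completely_metrizable_imp_metrizable_space metrizable_imp_t1_space)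

section \<open>Coding Borel sets by points of the Baire space\<close>

text \<open>\<open>g\<close> labels the tree of finite sequences, and
  \<open>\<lambda>l. g (n # l)\<close> is the labelling below child \<open>n\<close>. Inductiveness
  admits only well-founded constructions.\<close>

inductive codes :: "(nat \<Rightarrow> 'a set) \<Rightarrow> (nat list \<Rightarrow> nat) \<Rightarrow> 'a set \<Rightarrow> bool" for G where
  gen: "g [] = k + 2 \<Longrightarrow> codes G g (G k)"
| compl: "g [] = 0 \<Longrightarrow> codes G (\<lambda>l. g (0 # l)) A \<Longrightarrow> codes G g (- A)"
| union: "g [] = 1 \<Longrightarrow> (\<And>n. codes G (\<lambda>l. g (n # l)) (A n)) \<Longrightarrow> codes G g (\<Union>n. A n)"

text \<open>The root label determines which rule was applied, so induction recovers the set from its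
  code.\<close>

lemma codes_unique: "codes G g A \<Longrightarrow> codes G g B \<Longrightarrow> A = B"
proof (induction arbitrary: B rule: codes.induct)
  case (gen g k)
  show ?case using gen(2,1) by cases auto
next
  case (compl g A)
  show ?case using compl(4,1) by cases (auto dest: compl(3))
next
  case (union g A)
  note IH = union.IH
  show ?case using union.prems union.hyps(1)
  proof cases
    case (union A')
    then have "A = A'" by (intro ext IH) simp
    then show ?thesis using union by simp
  qed auto
qed

lemma codes_exist:
  assumes "A \<in> sigma_sets UNIV (range G)"
  shows "\<exists>g. codes G g A"
  using assms
proof induction
  case (Basic A)
  then obtain k where "A = G k" by blast
  then show ?case by (auto intro: codes.gen[of "\<lambda>_. k + 2"])
next
  case Empty
  \<comment> \<open>No rule yields the empty set directly; it is coded as the complement of the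
    union of \<open>G 0\<close> and \<open>- G 0\<close>.\<close>
  have gen: "codes G (\<lambda>_. 2) (G 0)" by (rule codes.gen) simp
  have cogen: "codes G (\<lambda>l. case l of [] \<Rightarrow> 0 | _ \<Rightarrow> 2) (- G 0)"
    by (rule codes.compl) (simp_all add: gen)
  have "codes G (\<lambda>l. case l of [] \<Rightarrow> 1 | n # l \<Rightarrow> (if n = 0 then 2 else case l of [] \<Rightarrow> 0 | _ \<Rightarrow> 2))
          (\<Union>n::nat. if n = 0 then G 0 else - G 0)" (is "codes G ?c ?U")
  proof (rule codes.union)
    show "codes G (\<lambda>l. ?c (n # l)) (if n = 0 then G 0 else - G 0)" for n
      by (cases "n = 0") (simp_all add: gen cogen)
  qed simp
  then have "codes G (\<lambda>l. case l of [] \<Rightarrow> 0 | _ # l \<Rightarrow> ?c l) (- ?U)"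
    by (intro codes.compl) (simp, simp only: list.case)
  moreover have "x \<in> ?U" for x
    by (cases "x \<in> G 0") (auto intro: UN_I[of 0] UN_I[of 1])
  then have "- ?U = {}" by blast
  ultimately show ?case by metis
next
  case (Compl A)
  then obtain g where g: "codes G g A" by blast
  have "codes G (\<lambda>l. case l of [] \<Rightarrow> 0 | _ # l \<Rightarrow> g l) (- A)"
    by (rule codes.compl) (use g in auto)
  then show ?case by (auto simp: Compl_eq_Diff_UNIV)
next
  case (Union A)
  then obtain g where g: "\<And>n. codes G (g n) (A n)" by metis
  have "codes G (\<lambda>l. case l of [] \<Rightarrow> 1 | n # l \<Rightarrow> g n l) (\<Union>n. A n)"
    by (rule codes.union) (use g in auto)
  then show ?case by blast
qed

lemma Borel_sets_inj:
  "\<exists>c :: 'a::second_countable_topology set \<Rightarrow> nat \<Rightarrow> nat. inj_on c (sets borel)"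
proof -
  obtain B :: "'a set set" where B: "countable B" "topological_basis B"
    using ex_countable_basis by auto
  \<comment> \<open>Inserting the empty set guarantees a nonempty countable set, which
    \<open>from_nat_into\<close> enumerates exactly.\<close>
  define G where "G = from_nat_into (insert {} B)"
  have "range G = insert {} B"
    unfolding G_def using B(1) by (intro range_from_nat_into) auto
  moreover have "topological_basis (insert {} B)"
    using B(2) unfolding topological_basis_def by (metis insertE open_empty subset_insertI2)
  ultimately have "borel = sigma UNIV (range G)"
    using borel_eq_countable_basis[of "insert {} B"] B(1) by simp
  moreover have "sets (sigma UNIV (range G)) = sigma_sets UNIV (range G)"
    by (rule sets_measure_of) simp
  ultimately have "sets borel = sigma_sets UNIV (range G)" by metis
  then have "\<forall>A\<in>sets borel. \<exists>g. codes G g A" using codes_exist by metis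
  then obtain g where g: "\<And>A. A \<in> sets borel \<Longrightarrow> codes G (g A) A" by metis
  have "inj_on (\<lambda>A n. g A (from_nat n)) (sets borel)"
  proof (rule inj_onI)
    fix A A' :: "'a set"
    assume A: "A \<in> sets borel" "A' \<in> sets borel"
      and eq: "(\<lambda>n. g A (from_nat n)) = (\<lambda>n. g A' (from_nat n))"
    have "g A l = g A' l" for l using fun_cong[OF eq, of "to_nat l"] by simp
    then have "g A = g A'" by blast
    then show "A = A'" using g[OF A(1)] g[OF A(2)] codes_unique by metis
  qed
  then show ?thesis by blast
qed

section \<open>Cantor-Bernstein with a record of the gluing\<close>

text \<open>The last conjunct keeps track of whether a value comes from \<open>i\<close> or from the
  inverse of \<open>j\<close>; it later bounds the sets assigned to singletons.\<close>

lemma Cantor_Bernstein_glued: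
  assumes i: "inj_on i A" "i ` A \<subseteq> B" and j: "inj_on j B" "j ` B \<subseteq> A"
  shows "\<exists>h. bij_betw h A B \<and> (\<forall>a\<in>A. h a = i a \<or> j (h a) = a)"
proof -
  \<comment> \<open>By the fixed point equation, the points of \<open>A\<close> outside
    \<open>X\<close> are the \<open>j\<close>-images of the points of \<open>B\<close> that
    \<open>i\<close> does not reach from \<open>X\<close>.\<close>
  define X where "X = lfp (\<lambda>X. A - j ` (B - i ` X))"
  have X: "X = A - j ` (B - i ` X)"
    unfolding X_def by (rule lfp_unfold) (intro monoI Diff_mono image_mono subset_refl)
  define h where "h a = (if a \<in> X then i a else inv_into B j a)" for a
  have out: "\<exists>b\<in>B - i ` X. j b = a \<and> h a = b" if "a \<in> A - X" for a
  proof -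
    from that X have "a \<in> j ` (B - i ` X)" by blast
    then obtain b where b: "b \<in> B - i ` X" "a = j b" by blast
    then have "h a = b" using that j(1) by (simp add: h_def)
    with b show ?thesis by blast
  qed
  have XA: "X \<subseteq> A" using X by blast
  have "inj_on h A"
  proof (rule inj_onI)
    fix a a' assume a: "a \<in> A" "a' \<in> A" "h a = h a'"
    have "h x \<in> i ` X \<longleftrightarrow> x \<in> X" if "x \<in> A" for x
    proof (cases "x \<in> X")
      case True
      then show ?thesis by (simp add: h_def)
    next
      case False
      then show ?thesis using out[of x] that by (metis DiffD2 DiffI)
    qed
    then have "a \<in> X \<longleftrightarrow> a' \<in> X" using a by metis
    then show "a = a'"
    proof (cases "a \<in> X")
      case True
      then show ?thesis using \<open>a \<in> X \<longleftrightarrow> a' \<in> X\<close> a i(1) by (simp add: h_def inj_on_def)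
    next
      case False
      then show ?thesis using \<open>a \<in> X \<longleftrightarrow> a' \<in> X\<close> out[of a] out[of a'] a by auto
    qed
  qed
  moreover have "h ` A \<subseteq> B"
    using out i(2) XA by (force simp: h_def)
  moreover have "b \<in> h ` A" if b: "b \<in> B" for b
  proof (cases "b \<in> i ` X")
    case True
    then show ?thesis using XA by (force simp: h_def)
  next
    case False
    then have "j b \<in> A - X" using b j(2) X by blast
    then have "h (j b) = b" using b j(1) by (simp add: h_def)
    then show ?thesis using \<open>j b \<in> A - X\<close> by force
  qed
  moreover have "h a = i a \<or> j (h a) = a" if "a \<in> A" for a
    using out[of a] that by (auto simp: h_def)
  ultimately show ?thesis by (intro exI[of _ h]) (auto simp: bij_betw_def)
qed

section \<open>Unions of fewer than continuum many meager sets\<close>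

text \<open>A function is determined by the characteristic function of its graph, with pairs
  numbered by \<open>prod_encode\<close>.\<close>

lemma card_Baire_space: "|UNIV :: (nat \<Rightarrow> nat) set| \<le>o continuum"
proof -
  let ?g = "\<lambda>(x :: nat \<Rightarrow> nat) n. x (fst (prod_decode n)) = snd (prod_decode n)"
  have "inj ?g"
  proof (rule injI)
    fix x y assume eq: "?g x = ?g y"
    have "x i = y i" for i using fun_cong[OF eq, of "prod_encode (i, x i)"] by simp
    then show "x = y" by blast
  qed
  then have "|UNIV :: (nat \<Rightarrow> nat) set| \<le>o |UNIV :: (nat \<Rightarrow> bool) set|"
    by (intro card_of_ordLeqI[of ?g]) auto
  moreover have "Func (UNIV :: nat set) (UNIV :: bool set) = UNIV" by (auto simp: Func_def)
  ultimately show ?thesis by (simp add: cexp_def ctwo_def Field_card_of Field_natLeq)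
qed

lemma infinite_UNIV_Baire_space: "infinite (UNIV :: (nat \<Rightarrow> nat) set)"
proof
  assume "finite (UNIV :: (nat \<Rightarrow> nat) set)"
  then have "finite (range (\<lambda>n _ :: nat. n :: nat))" by (rule finite_subset[OF subset_UNIV])
  moreover have "inj (\<lambda>n _ :: nat. n :: nat)" by (auto simp: inj_def dest: fun_cong)
  ultimately have "finite (UNIV :: nat set)" by (rule finite_imageD)
  then show False by simp
qed

lemma finite_card_less_Baire_space:
  "finite F \<Longrightarrow> |F| <o |UNIV :: (nat \<Rightarrow> nat) set|"
  using infinite_UNIV_Baire_space
  by (intro finite_ordLess_infinite card_of_Well_order) (simp_all add: Field_card_of)

lemma small_Union_meager:
  assumes "add_meager =o continuum"
    and "|F| <o |UNIV :: (nat \<Rightarrow> nat) set|" and "\<And>A. A \<in> F \<Longrightarrow> meager A"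
  shows "meager (\<Union>F :: (nat \<Rightarrow> nat) set)"
proof (rule ccontr)
  assume "\<not> meager (\<Union>F)"
  then have "add_meager \<le>o |F|"
    using assms(3) by (intro add_meager_least(2)) (auto simp: nonadditive_families_def)
  also note assms(2)
  also note card_Baire_space
  also have "continuum =o add_meager" using assms(1) by (rule ordIso_symmetric)
  finally show False by (rule ordLess_irreflexive[THEN notE])
qed

lemma meager_Un:
  assumes "add_meager =o continuum"
    and "meager A" "meager (B :: (nat \<Rightarrow> nat) set)"
  shows "meager (A \<union> B)"
proof -
  have "meager (\<Union>{A, B})"
    by (rule small_Union_meager[OF assms(1) finite_card_less_Baire_space]) (use assms in auto)
  then show ?thesis by simp
qed

section \<open>The cofinal chain of meager Borel sets\<close>

abbreviation meager_Borel :: "(nat \<Rightarrow> nat) set set" where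
  "meager_Borel \<equiv> {B. B \<in> sets borel \<and> meager B}"

text \<open>Recursion runs along the cardinal well-order of the points, whose proper initial
  segments are small enough for additivity to apply. Points serve both as indices and as codes, so
  \<open>A\<close> is absorbed at stage \<open>c A\<close>.\<close>

lemma meager_scale:
  assumes add: "add_meager =o continuum"
  defines "L \<equiv> |UNIV :: (nat \<Rightarrow> nat) set| - Id"
  obtains N and e :: "(nat \<Rightarrow> nat) \<Rightarrow> (nat \<Rightarrow> nat) \<Rightarrow> nat \<Rightarrow> nat"
  where "\<And>\<alpha>. N \<alpha> \<in> meager_Borel" "\<And>A. A \<in> meager_Borel \<Longrightarrow> \<exists>\<alpha>. A \<subseteq> N \<alpha>"
    "\<And>\<alpha> \<beta>. (\<alpha>, \<beta>) \<in> L \<Longrightarrow> N \<alpha> \<union> range (e \<alpha>) \<subseteq> N \<beta>"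
    "\<And>\<alpha>. inj (e \<alpha>)" "\<And>\<alpha>. range (e \<alpha>) \<inter> N \<alpha> = {}" "\<And>\<alpha>. meager (range (e \<alpha>))"
    "\<And>\<alpha> A. A \<in> sets borel \<Longrightarrow> e \<alpha> ` A \<in> sets borel"
proof -
  have "\<forall>M :: (nat \<Rightarrow> nat) set. \<exists>e :: (nat \<Rightarrow> nat) \<Rightarrow> nat \<Rightarrow> nat. meager M \<longrightarrow> inj e \<and>
      range e \<inter> M = {} \<and> meager (range e) \<and> (\<forall>A\<in>sets borel. e ` A \<in> sets borel)"
    by (intro allI) (use meager_avoiding_embedding in simp)
  from choice[OF this] obtain e :: "(nat \<Rightarrow> nat) set \<Rightarrow> (nat \<Rightarrow> nat) \<Rightarrow> nat \<Rightarrow> nat" where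
    e: "\<forall>M. meager M \<longrightarrow> inj (e M) \<and> range (e M) \<inter> M = {} \<and>
      meager (range (e M)) \<and> (\<forall>A\<in>sets borel. e M ` A \<in> sets borel)" ..
  note e = e[rule_format]
  have "\<forall>A :: (nat \<Rightarrow> nat) set. \<exists>B. meager A \<longrightarrow> A \<subseteq> B \<and> B \<in> meager_Borel"
    by (simp add: meager_Borel_hull)
  from choice[OF this] obtain H where
    H: "\<forall>A. meager A \<longrightarrow> A \<subseteq> H A \<and> H A \<in> meager_Borel" ..
  note H = H[rule_format]
  obtain c :: "(nat \<Rightarrow> nat) set \<Rightarrow> nat \<Rightarrow> nat" where c: "inj_on c (sets borel)"
    using Borel_sets_inj by blast
  have meager_empty: "meager ({} :: (nat \<Rightarrow> nat) set)"
    by (rule meager_subset[OF meager_singleton]) simp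
  \<comment> \<open>\<open>B\<close> lists all meager Borel sets by their codes, with the empty set
    as default elsewhere.\<close>
  define B where "B \<alpha> = (if \<alpha> \<in> c ` meager_Borel then inv_into meager_Borel c \<alpha> else {})" for \<alpha>
  have B_meager: "meager (B \<alpha>)" for \<alpha>
    using inv_into_into[of \<alpha> c meager_Borel] meager_empty by (auto simp: B_def)
  have B_c: "B (c A) = A" if "A \<in> meager_Borel" for A
  proof -
    have "inj_on c meager_Borel" using c by (rule inj_on_subset) blast
    then show ?thesis using that by (simp add: B_def)
  qed
  let ?r = "|UNIV :: (nat \<Rightarrow> nat) set|"
  have wf: "wf L"
    using card_of_Well_order[of "UNIV :: (nat \<Rightarrow> nat) set"] by (simp add: L_def well_order_on_def)
  define step where "step N \<alpha> = B \<alpha> \<union> (\<Union>\<beta>\<in>underS ?r \<alpha>. N \<beta> \<union> range (e (N \<beta>)))" for N \<alpha>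
  define N where "N = wfrec L (\<lambda>N \<alpha>. H (step N \<alpha>))"
  have N: "N \<alpha> = H (step N \<alpha>)" for \<alpha>
  proof -
    \<comment> \<open>Only values at predecessors of \<open>\<alpha>\<close> enter the step, so
      cutting the function off there changes nothing.\<close>
    have "step (cut N L \<alpha>) \<alpha> = step N \<alpha>"
      unfolding step_def by (auto simp: cut_apply L_def underS_def)
    then show ?thesis unfolding N_def by (subst wfrec[OF wf]) simp
  qed
  have step_meager: "meager (step N \<alpha>)" if IH: "\<And>\<beta>. \<beta> \<in> underS ?r \<alpha> \<Longrightarrow> meager (N \<beta>)" for \<alpha>
  proof -
    have "\<alpha> \<in> Field ?r" by (simp add: Field_card_of)
    then have small: "|f ` underS ?r \<alpha>| <o ?r" for f :: "(nat \<Rightarrow> nat) \<Rightarrow> (nat \<Rightarrow> nat) set"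
      by (rule ordLeq_ordLess_trans[OF card_of_image card_of_underS[OF card_of_Card_order]])
    have "|{B \<alpha>}| <o ?r" by (rule finite_card_less_Baire_space) simp
    then have "|{B \<alpha>} \<union> (N ` underS ?r \<alpha> \<union> (\<lambda>\<beta>. range (e (N \<beta>))) ` underS ?r \<alpha>)| <o ?r"
      by (intro card_of_Un_ordLess_infinite[OF infinite_UNIV_Baire_space] small)
    then have "meager (\<Union>({B \<alpha>} \<union> (N ` underS ?r \<alpha> \<union> (\<lambda>\<beta>. range (e (N \<beta>))) ` underS ?r \<alpha>)))"
      by (rule small_Union_meager[OF add]) (use IH e B_meager in auto)
    then show ?thesis by (rule meager_subset) (auto simp: step_def)
  qed
  have N_meager: "meager (N \<alpha>)" for \<alpha>
    using wf
  proof (induction \<alpha>)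
    case (less \<alpha>)
    then have "meager (step N \<alpha>)" by (intro step_meager) (auto simp: L_def underS_def)
    then show ?case using H by (subst N) blast
  qed
  then have step_N: "step N \<alpha> \<subseteq> N \<alpha>" and N_P: "N \<alpha> \<in> meager_Borel" for \<alpha>
    using H[OF step_meager, of \<alpha>] N[of \<alpha>] by simp_all
  have cofinal: "\<exists>\<alpha>. A \<subseteq> N \<alpha>" if "A \<in> meager_Borel" for A
    using B_c[OF that] step_N[of "c A"] by (intro exI[of _ "c A"]) (simp add: step_def)
  have incr: "N \<alpha> \<union> range (e (N \<alpha>)) \<subseteq> N \<beta>" if "(\<alpha>, \<beta>) \<in> L" for \<alpha> \<beta>
  proof -
    have "\<alpha> \<in> underS ?r \<beta>" using that by (simp add: L_def underS_def)
    then have "N \<alpha> \<union> range (e (N \<alpha>)) \<subseteq> step N \<beta>" unfolding step_def by blast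
    then show ?thesis using step_N by blast
  qed
  show ?thesis
    by (rule that[of N "\<lambda>\<alpha>. e (N \<alpha>)"]) (use N_P cofinal incr e[OF N_meager] in simp_all)
qed

section \<open>A monotone bijection that is not an automorphism\<close>

text \<open>The order-theoretic core: topology enters only through the hypotheses on the chain
  \<open>N\<close>, the embeddings \<open>e\<close> and the coding \<open>c\<close>.\<close>

lemma not_reversible_of_scale:
  fixes P :: "'a set set" and L :: "'i rel" and N :: "'i \<Rightarrow> 'a set" and e :: "'i \<Rightarrow> 'a \<Rightarrow> 'a"
    and c :: "'a set \<Rightarrow> 'a"
  assumes wf: "wf L" and total: "total L"
    and empty: "{} \<in> P" and pairs: "\<And>p q. {p, q} \<in> P" and pq: "(p::'a) \<noteq> q"
    and closed: "\<And>\<alpha> A. A \<in> P \<Longrightarrow> N \<alpha> \<union> e \<alpha> ` A \<in> P"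
    and cofinal: "\<And>A. A \<in> P \<Longrightarrow> \<exists>\<alpha>. A \<subseteq> N \<alpha>"
    and incr: "\<And>\<alpha> \<beta>. (\<alpha>, \<beta>) \<in> L \<Longrightarrow> N \<alpha> \<union> range (e \<alpha>) \<subseteq> N \<beta>"
    and e_inj: "\<And>\<alpha>. inj (e \<alpha>)" and e_avoids: "\<And>\<alpha> a. e \<alpha> a \<notin> N \<alpha>"
    and c: "inj_on c P"
  shows "\<not> reversible_poset P (\<subseteq>)"
proof -
  have "\<exists>\<alpha>. A \<subseteq> N \<alpha> \<and> (\<forall>\<beta>. (\<beta>, \<alpha>) \<in> L \<longrightarrow> \<not> A \<subseteq> N \<beta>)" if A: "A \<in> P" for A
  proof -
    obtain \<alpha> where "\<alpha> \<in> {\<alpha>. A \<subseteq> N \<alpha>}" using cofinal[OF A] by blast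
    then show ?thesis by (rule wfE_min[OF wf]) blast
  qed
  then obtain \<rho> where \<rho>: "\<And>A. A \<in> P \<Longrightarrow> A \<subseteq> N (\<rho> A)"
    and \<rho>_least: "\<And>A \<beta>. A \<in> P \<Longrightarrow> (\<beta>, \<rho> A) \<in> L \<Longrightarrow> \<not> A \<subseteq> N \<beta>"
    by metis
  have tot: "\<alpha> = \<beta> \<or> (\<alpha>, \<beta>) \<in> L \<or> (\<beta>, \<alpha>) \<in> L" for \<alpha> \<beta>
    using total by (auto simp: total_on_def)
  have \<rho>_le: "\<rho> A = \<beta> \<or> (\<rho> A, \<beta>) \<in> L" if "A \<in> P" "A \<subseteq> N \<beta>" for A \<beta>
    using tot \<rho>_least that by blast
  define F where "F A = N (\<rho> A) \<union> e (\<rho> A) ` A" for A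
  define Q where "Q = {A \<in> P. \<exists>u v. u \<in> A \<and> v \<in> A \<and> u \<noteq> v}"
  have QP: "Q \<subseteq> P" by (auto simp: Q_def)
  have F_P: "F A \<in> P" if "A \<in> Q" for A
    using that QP closed by (auto simp: F_def)
  \<comment> \<open>\<open>F A\<close> has at least three points: two of \<open>A\<close> inside
    \<open>N (\<rho> A)\<close> and one in the range of \<open>e (\<rho> A)\<close> outside it. So
    \<open>F\<close> leaves all sets \<open>{u, v}\<close> to be hit by singletons.\<close>
  have F_large: "\<not> F A \<subseteq> {u, v}" if A: "A \<in> Q" for A u v
  proof
    assume F: "F A \<subseteq> {u, v}"
    obtain a b where ab: "a \<in> A" "b \<in> A" "a \<noteq> b" using A by (auto simp: Q_def)
    have "A \<subseteq> N (\<rho> A)" by (rule \<rho>) (use A QP in blast)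
    then have "a \<in> N (\<rho> A)" "b \<in> N (\<rho> A)" using ab by auto
    moreover have "e (\<rho> A) a \<in> F A" "N (\<rho> A) \<subseteq> F A" using ab by (auto simp: F_def)
    ultimately have "a \<in> {u, v}" "b \<in> {u, v}" "e (\<rho> A) a \<in> {u, v}" "a \<in> N (\<rho> A)" "b \<in> N (\<rho> A)"
      using F by (meson subsetD)+
    then show False using ab(3) e_avoids[of "\<rho> A" a] by auto
  qed
  have F_mono: "F A \<subseteq> F B" if AB: "A \<in> Q" "B \<in> Q" "A \<subseteq> B" for A B
  proof -
    have "A \<subseteq> N (\<rho> B)" using AB \<rho>[of B] QP by blast
    then have "\<rho> A = \<rho> B \<or> (\<rho> A, \<rho> B) \<in> L" using \<rho>_le QP AB(1) by blast
    then show ?thesis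
    proof
      assume "(\<rho> A, \<rho> B) \<in> L"
      then show ?thesis using incr by (fastforce simp: F_def)
    qed (use AB in \<open>auto simp: F_def\<close>)
  qed
  have F_less: "F A \<noteq> F B" if A: "A \<in> Q" and B: "B \<in> Q" and less: "(\<rho> A, \<rho> B) \<in> L" for A B
  proof
    assume eq: "F A = F B"
    obtain b where "b \<in> B" using B by (auto simp: Q_def)
    then have "e (\<rho> B) b \<in> F A" by (simp add: eq) (simp add: F_def)
    moreover have "F A \<subseteq> N (\<rho> B)" using incr[OF less] by (auto simp: F_def)
    ultimately show False using e_avoids by blast
  qed
  have F_inj: "inj_on F Q"
  proof (rule inj_onI)
    fix A B assume AB: "A \<in> Q" "B \<in> Q" "F A = F B"
    then have \<rho>eq: "\<rho> A = \<rho> B" using tot[of "\<rho> A" "\<rho> B"] F_less by metis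
    \<comment> \<open>Once the rank is known, removing \<open>N (\<rho> A)\<close> leaves a copy of
      \<open>A\<close>.\<close>
    have "e (\<rho> A) ` A = F A - N (\<rho> A)" "e (\<rho> B) ` B = F B - N (\<rho> B)"
      using e_avoids by (auto simp: F_def)
    then have "e (\<rho> A) ` A = e (\<rho> A) ` B" using AB(3) \<rho>eq by simp
    then show "A = B" using e_inj inj_image_eq_iff by metis
  qed
  define S where "S = P - {{}} - F ` Q"
  have SP: "S \<subseteq> P" by (auto simp: S_def)
  have pair_S: "{u, v} \<in> S" for u v
    using pairs F_large[of _ u v] by (auto simp: S_def)
  have single_S: "{u} \<in> S" for u using pair_S[of u u] by simp
  define j where "j A = e (\<rho> A) (c A)" for A
  have j_less: "j A \<noteq> j B" if "(\<rho> A, \<rho> B) \<in> L" for A B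
    using incr[OF that] e_avoids[of "\<rho> B"] unfolding j_def by (metis UnCI rangeI subsetD)
  have "inj_on j S"
  proof (rule inj_onI)
    fix A B assume AB: "A \<in> S" "B \<in> S" "j A = j B"
    then have "\<rho> A = \<rho> B" using tot[of "\<rho> A" "\<rho> B"] j_less by metis
    then have "c A = c B" using AB(3) e_inj by (simp add: j_def inj_eq)
    then show "A = B" using c AB SP by (meson inj_onD subsetD)
  qed
  moreover have "inj_on (\<lambda>a. {a}) UNIV" "(\<lambda>a. {a}) ` UNIV \<subseteq> S" using single_S by auto
  ultimately obtain h where h: "bij_betw h UNIV S" and h_glued: "\<And>a. h a = {a} \<or> j (h a) = a"
    using Cantor_Bernstein_glued[of "\<lambda>a. {a}" UNIV S j] by auto
  have h_S: "h a \<in> S" for a using h by (auto simp: bij_betw_def)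
  have single_P: "{a} \<in> P" for a using pairs[of a a] by simp
  \<comment> \<open>If \<open>h a\<close> is not \<open>{a}\<close>, then \<open>a = j (h a)\<close>
    lies outside \<open>N (\<rho> (h a))\<close>. So the rank of \<open>{a}\<close> is not below
    that of \<open>h a\<close>, and \<open>N (\<rho> {a})\<close> contains
    \<open>h a\<close>.\<close>
  have h_bound: "h a \<subseteq> N (\<rho> {a})" for a
  proof (cases "h a = {a}")
    case True
    then show ?thesis using \<rho>[OF single_P] by simp
  next
    case False
    then have a: "a = e (\<rho> (h a)) (c (h a))" using h_glued[of a] by (simp add: j_def)
    have ha: "h a \<subseteq> N (\<rho> (h a))" using \<rho> h_S SP by blast
    have "(\<rho> {a}, \<rho> (h a)) \<notin> L"
    proof
      assume "(\<rho> {a}, \<rho> (h a)) \<in> L"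
      then have "a \<in> N (\<rho> (h a))" using \<rho>[OF single_P, of a] incr by blast
      then show False using a e_avoids by metis
    qed
    then have "\<rho> (h a) = \<rho> {a} \<or> (\<rho> (h a), \<rho> {a}) \<in> L" using tot by blast
    then show ?thesis
    proof
      assume "(\<rho> (h a), \<rho> {a}) \<in> L"
      then show ?thesis using incr ha by blast
    qed (use ha in simp)
  qed
  define f where "f A = (if A = {} then {} else if A \<in> Q then F A else h (the_elem A))" for A
  have f_empty: "f {} = {}" by (simp add: f_def)
  have f_single: "f {a} = h a" for a by (simp add: f_def Q_def)
  have f_Q: "f A = F A" if "A \<in> Q" for A using that by (auto simp: f_def Q_def)
  have P_cases: "A = {} \<or> (\<exists>a. A = {a}) \<or> A \<in> Q" if "A \<in> P" for A
    using that by (auto simp: Q_def) (metis empty_iff insertI1 set_eqI singletonD)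
  have P_eq: "P = insert {} (range (\<lambda>a. {a}) \<union> Q)"
    using P_cases QP single_P empty by blast
  have f_img: "f ` P = P"
  proof -
    have "f ` P = insert {} (range h \<union> F ` Q)"
      by (subst P_eq) (simp add: image_Un image_image f_empty f_single f_Q cong: image_cong)
    also have "range h = S" using h by (simp add: bij_betw_def)
    also have "insert {} (S \<union> F ` Q) = P" using F_P empty by (auto simp: S_def)
    finally show ?thesis .
  qed
  have h_nonempty: "h a \<noteq> {}" and h_notF: "h a \<notin> F ` Q" for a
    using h_S[of a] by (auto simp: S_def)
  have F_nonempty: "F A \<noteq> {}" if "A \<in> Q" for A using F_large[OF that] by blast
  have "inj_on f P"
  proof (rule inj_onI)
    fix A B assume AB: "A \<in> P" "B \<in> P" "f A = f B"
    from P_cases[OF AB(1)] P_cases[OF AB(2)] show "A = B"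
    proof (elim disjE exE)
      fix a b assume "A = {a}" "B = {b}"
      then show ?thesis using AB(3) h by (simp add: f_single bij_betw_def inj_eq)
    next
      assume "A \<in> Q" "B \<in> Q"
      then show ?thesis using AB(3) F_inj by (simp add: f_Q inj_on_def)
    next
      fix a assume "A = {a}" "B \<in> Q"
      then show ?thesis using AB(3) h_notF[of a] by (auto simp: f_single f_Q)
    next
      fix b assume "A \<in> Q" "B = {b}"
      then show ?thesis using AB(3) h_notF[of b] by (metis f_single f_Q imageI)
    next
      fix a assume "A = {a}" "B = {}"
      then show ?thesis using AB(3) h_nonempty by (simp add: f_single f_empty)
    next
      fix b assume "A = {}" "B = {b}"
      then show ?thesis using AB(3) h_nonempty by (metis f_single f_empty)
    next
      assume "A \<in> Q" "B = {}"
      then show ?thesis using AB(3) F_nonempty by (simp add: f_Q f_empty)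
    next
      assume "A = {}" "B \<in> Q"
      then show ?thesis using AB(3) F_nonempty by (metis f_Q f_empty)
    qed simp
  qed
  then have bij: "bij_betw f P P" using f_img by (simp add: bij_betw_def)
  have mono: "monotone_on P (\<subseteq>) (\<subseteq>) f"
  proof (rule monotone_onI)
    fix A B assume A: "A \<in> P" and B: "B \<in> P" and "A \<subseteq> B"
    show "f A \<subseteq> f B"
    proof (cases "A = {} \<or> A = B")
      case True
      then show ?thesis using f_empty by auto
    next
      case False
      \<comment> \<open>A nonempty proper subset forces \<open>B\<close> to have two points.\<close>
      have BQ: "B \<in> Q" using P_cases[OF B] False \<open>A \<subseteq> B\<close> by blast
      show ?thesis
      proof (cases "A \<in> Q")
        case True
        then show ?thesis using F_mono BQ \<open>A \<subseteq> B\<close> by (simp add: f_Q)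
      next
        assume "A \<notin> Q"
        then obtain a where a: "A = {a}" using P_cases[OF A] False by blast
        \<comment> \<open>The chain of inclusions is \<open>h a\<close>,
          \<open>N (\<rho> {a})\<close>, \<open>N (\<rho> B)\<close>, \<open>F B\<close>.\<close>
        have "{a} \<subseteq> N (\<rho> B)" using \<rho>[OF B] \<open>A \<subseteq> B\<close> a by blast
        from \<rho>_le[OF single_P this] have "N (\<rho> {a}) \<subseteq> N (\<rho> B)" using incr by auto
        then show ?thesis using h_bound[of a] BQ a by (auto simp: f_single f_Q F_def)
      qed
    qed
  qed
  have "\<not> poset_automorphism P (\<subseteq>) f"
  proof
    assume aut: "poset_automorphism P (\<subseteq>) f"
    \<comment> \<open>An automorphism would reflect the inclusion of \<open>{p}\<close> in
      \<open>{p, q}\<close> to the two singletons mapped there, making them equal.\<close>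
    have "{p} \<in> range h" "{p, q} \<in> range h"
      using h single_S pair_S by (simp_all add: bij_betw_def)
    then obtain a b where ab: "h a = {p}" "h b = {p, q}" by (metis imageE)
    have "\<forall>x\<in>P. \<forall>y\<in>P. x \<subseteq> y \<longleftrightarrow> f x \<subseteq> f y"
      using aut by (simp add: poset_automorphism_def)
    then have "{a} \<subseteq> {b} \<longleftrightarrow> f {a} \<subseteq> f {b}" using single_P by (meson bspec)
    then have "a = b" using ab by (simp add: f_single)
    then show False using ab pq by auto
  qed
  then show ?thesis using bij mono unfolding reversible_poset_def by blast
qed

theorem proposition6p7:
  assumes "add_meager =o continuum"
  shows "\<not> reversible_poset {B :: (nat \<Rightarrow> nat) set. B \<in> sets borel \<and> meager B} (\<subseteq>)"
proof (rule meager_scale[OF assms])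
  let ?L = "|UNIV :: (nat \<Rightarrow> nat) set| - Id"
  fix N and e :: "(nat \<Rightarrow> nat) \<Rightarrow> (nat \<Rightarrow> nat) \<Rightarrow> nat \<Rightarrow> nat"
  assume N: "\<And>\<alpha>. N \<alpha> \<in> meager_Borel" "\<And>A. A \<in> meager_Borel \<Longrightarrow> \<exists>\<alpha>. A \<subseteq> N \<alpha>"
      "\<And>\<alpha> \<beta>. (\<alpha>, \<beta>) \<in> ?L \<Longrightarrow> N \<alpha> \<union> range (e \<alpha>) \<subseteq> N \<beta>"
      and e: "\<And>\<alpha>. inj (e \<alpha>)" "\<And>\<alpha>. range (e \<alpha>) \<inter> N \<alpha> = {}" "\<And>\<alpha>. meager (range (e \<alpha>))"
        "\<And>\<alpha> A. A \<in> sets borel \<Longrightarrow> e \<alpha> ` A \<in> sets borel"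
  obtain c :: "(nat \<Rightarrow> nat) set \<Rightarrow> nat \<Rightarrow> nat" where c: "inj_on c (sets borel)"
    using Borel_sets_inj by blast
  have r: "well_order_on UNIV |UNIV :: (nat \<Rightarrow> nat) set|" by (rule card_of_well_order_on)
  have singleton: "{x} \<in> meager_Borel" for x
    using meager_singleton closed_singleton_Baire_space by (simp add: borel_closed)
  have Un: "A \<union> B \<in> meager_Borel" if "A \<in> meager_Borel" "B \<in> meager_Borel" for A B
    using that meager_Un[OF assms] by (simp add: sets.Un)
  show ?thesis
  proof (rule not_reversible_of_scale)
    show "wf ?L" using r by (simp add: well_order_on_def)
    show "total ?L" using r by (auto simp: well_order_on_def linear_order_on_def total_on_def)
    show "{} \<in> meager_Borel" using meager_subset[OF meager_singleton] by simp
    show "{p, q} \<in> meager_Borel" for p q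
      using Un[OF singleton singleton, of p q] by (simp add: insert_commute)
    show "(\<lambda>_. 0 :: nat) \<noteq> (\<lambda>_. 1)" by (simp add: fun_eq_iff)
    show "N \<alpha> \<union> e \<alpha> ` A \<in> meager_Borel" if "A \<in> meager_Borel" for \<alpha> A
    proof (rule Un[OF N(1)])
      have "meager (e \<alpha> ` A)" by (rule meager_subset[OF e(3)]) auto
      then show "e \<alpha> ` A \<in> meager_Borel" using that e(4) by simp
    qed
    show "\<exists>\<alpha>. A \<subseteq> N \<alpha>" if "A \<in> meager_Borel" for A using that by (rule N(2))
    show "N \<alpha> \<union> range (e \<alpha>) \<subseteq> N \<beta>" if "(\<alpha>, \<beta>) \<in> ?L" for \<alpha> \<beta> using that by (rule N(3))
    show "inj (e \<alpha>)" for \<alpha> by (rule e(1))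
    show "e \<alpha> a \<notin> N \<alpha>" for \<alpha> a using e(2)[of \<alpha>] by blast
    show "inj_on c meager_Borel" using c by (rule inj_on_subset) blast
  qed
qed

end
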